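(* Let $\alpha,\beta\ge 0$ with $\alpha+\beta>0$. The transformation $E_{\alpha,\beta}: f\mapsto(\widetilde{f_\ell},\widetilde{f_{\mathrm r}})$, defined on $\mathfrak C(\mathbb R_\sharp)$ with values a priori in pairs of continuous functions on $\mathbb R$, is an isomorphism of $\mathfrak C(\mathbb R_\sharp)$ and $\mathcal C_{\alpha,\beta}$.
   Context: $\mathfrak C[-\infty,\infty]$ is the space of real continuous functions on $\mathbb R$ with finite limits at $\pm\infty$, with the supremum norm; $\mathcal C=(\mathfrak C[-\infty,\infty])^2$ (with a usual product norm, e.g. the maximum norm). $\mathfrak C(\mathbb R_\sharp)$ is the Banach space (supremum norm) of real continuous functions on $(-\infty,0)\cup(0,\infty)$ that have finite limits at $\pm\infty$ and finite one-sided limits $f(0-),f(0+)$ at $0$. For a function $f$: $f^{T}(x)=f(-x)$, $f^o=\frac12(f-f^{T})$. $e_a(x)=e^{-ax}$; $(f*g)(x)=\int_0^x f(x-y)g(y)\,dy$ for $x\in\mathbb R$. For $f\in\mathfrak C(\mathbb R_\sharp)$ the functions $\widetilde{f_\ell},\widetilde{f_{\mathrm r}}:\mathbb R\to\mathbb R$ are defined, for $x>0$, by $$\widetilde{f_\ell}(-x)=f(-x),\qquad \widetilde{f_{\mathrm r}}(x)=f(x),$$ $$\widetilde{f_\ell}(x)=f(-x)+2\alpha\int_0^x e^{-(\alpha+\beta)(x-y)}[f(y)-f(-y)]\,dy,$$ $$\widetilde{f_{\mathrm r}}(-x)=f(x)-2\beta\int_0^x e^{-(\alpha+\beta)(x-y)}[f(y)-f(-y)]\,dy,$$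 and $\widetilde{f_\ell}(0)=f(0-)$, $\widetilde{f_{\mathrm r}}(0)=f(0+)$. $\mathcal C_{\alpha,\beta}$ is the subspace of $(g_1,g_2)\in\mathcal C$ such that, on $\mathbb R$, $$g_1^o=\alpha\, e_{\alpha+\beta}*(g_2-g_1^{T}),\qquad g_2^o=\beta\, e_{\alpha+\beta}*(g_2-g_1^{T}).$$ "Isomorphism" means a linear bijection that is bounded together with its inverse. *)

theory Defs
  imports "HOL-Analysis.Analysis" "HOL-Library.Function_Algebras"
begin

instantiation "fun" :: (type, real_vector) real_vector
begin

definition "c *\<^sub>R f = (\<lambda>x. c *\<^sub>R f x)"

instance
  by standard (auto simp: scaleR_fun_def fun_eq_iff algebra_simps)

end

definition C_ext :: "(real \<Rightarrow> real) set" where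
  "C_ext = {f. continuous_on UNIV f
      \<and> (\<exists>l. (f \<longlongrightarrow> l) at_bot) \<and> (\<exists>l. (f \<longlongrightarrow> l) at_top)}"

text \<open>
  A function on the punctured line is represented by the total function that is
  extended by the value 0 at the point 0. This makes the representation unique and
  compatible with the linear structure; the value at 0 plays no other role.
\<close>

definition C_sharp :: "(real \<Rightarrow> real) set" where
  "C_sharp = {f. f 0 = 0 \<and> continuous_on (- {0}) f
      \<and> (\<exists>l. (f \<longlongrightarrow> l) at_bot) \<and> (\<exists>l. (f \<longlongrightarrow> l) at_top)
      \<and> (\<exists>l. (f \<longlongrightarrow> l) (at_left 0)) \<and> (\<exists>l. (f \<longlongrightarrow> l) (at_right 0))}"

definition sup_norm_on :: "real set \<Rightarrow> (real \<Rightarrow> real) \<Rightarrow> real" where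
  "sup_norm_on A f = (SUP x\<in>A. \<bar>f x\<bar>)"

definition norm_sharp :: "(real \<Rightarrow> real) \<Rightarrow> real" where
  "norm_sharp f = sup_norm_on (- {0}) f"

definition norm_pair :: "(real \<Rightarrow> real) \<times> (real \<Rightarrow> real) \<Rightarrow> real" where
  "norm_pair g = max (sup_norm_on UNIV (fst g)) (sup_norm_on UNIV (snd g))"

definition reflect :: "(real \<Rightarrow> real) \<Rightarrow> real \<Rightarrow> real" where
  "reflect f x = f (- x)"

definition odd_part :: "(real \<Rightarrow> real) \<Rightarrow> real \<Rightarrow> real" where
  "odd_part f = (1 / 2) *\<^sub>R (f - reflect f)"

definition exp_fun :: "real \<Rightarrow> real \<Rightarrow> real" where
  "exp_fun a x = exp (- a * x)"

text \<open>The interval integral is oriented: for \<open>x < 0\<close> it is minus the integral over \<open>(x, 0)\<close>.\<close>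

definition conv :: "(real \<Rightarrow> real) \<Rightarrow> (real \<Rightarrow> real) \<Rightarrow> real \<Rightarrow> real" where
  "conv f g x = (LBINT y=ereal 0..ereal x. f (x - y) * g y)"

definition C_ab :: "real \<Rightarrow> real \<Rightarrow> ((real \<Rightarrow> real) \<times> (real \<Rightarrow> real)) set" where
  "C_ab \<alpha> \<beta> = {(g\<^sub>1, g\<^sub>2). g\<^sub>1 \<in> C_ext \<and> g\<^sub>2 \<in> C_ext
      \<and> odd_part g\<^sub>1 = \<alpha> *\<^sub>R conv (exp_fun (\<alpha> + \<beta>)) (g\<^sub>2 - reflect g\<^sub>1)
      \<and> odd_part g\<^sub>2 = \<beta> *\<^sub>R conv (exp_fun (\<alpha> + \<beta>)) (g\<^sub>2 - reflect g\<^sub>1)}"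

definition tilde_l :: "real \<Rightarrow> real \<Rightarrow> (real \<Rightarrow> real) \<Rightarrow> real \<Rightarrow> real" where
  "tilde_l \<alpha> \<beta> f x =
     (if x < 0 then f x
      else if x = 0 then Lim (at_left 0) f
      else f (- x) + 2 * \<alpha> *
        (LBINT y=ereal 0..ereal x. exp (- (\<alpha> + \<beta>) * (x - y)) * (f y - f (- y))))"

text \<open>For \<open>x < 0\<close> the defining formula is read at the positive point \<open>- x\<close>.\<close>

definition tilde_r :: "real \<Rightarrow> real \<Rightarrow> (real \<Rightarrow> real) \<Rightarrow> real \<Rightarrow> real" where
  "tilde_r \<alpha> \<beta> f x =
     (if x > 0 then f x
      else if x = 0 then Lim (at_right 0) f
      else f (- x) - 2 * \<beta> *
        (LBINT y=ereal 0..ereal (- x). exp (- (\<alpha> + \<beta>) * (- x - y)) * (f y - f (- y))))"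

definition E_ab :: "real \<Rightarrow> real \<Rightarrow> (real \<Rightarrow> real) \<Rightarrow> (real \<Rightarrow> real) \<times> (real \<Rightarrow> real)" where
  "E_ab \<alpha> \<beta> f = (tilde_l \<alpha> \<beta> f, tilde_r \<alpha> \<beta> f)"

text \<open>
  The library's \<open>bounded_linear\<close> concerns maps between whole types; here the normed
  spaces are linear subspaces \<open>S\<close>, \<open>T\<close> of real vector spaces with norms \<open>p\<close>, \<open>q\<close> on them.
  Linearity of the inverse follows from linearity of the bijection.
\<close>

definition normed_isomorphism ::
  "'a::real_vector set \<Rightarrow> ('a \<Rightarrow> real) \<Rightarrow> 'b::real_vector set \<Rightarrow> ('b \<Rightarrow> real) \<Rightarrow> ('a \<Rightarrow> 'b) \<Rightarrow> bool" where
  "normed_isomorphism S p T q F \<longleftrightarrow>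
     subspace S \<and> subspace T
     \<and> (\<forall>x\<in>S. \<forall>y\<in>S. F (x + y) = F x + F y)
     \<and> (\<forall>c. \<forall>x\<in>S. F (c *\<^sub>R x) = c *\<^sub>R F x)
     \<and> bij_betw F S T
     \<and> (\<exists>K. \<forall>x\<in>S. q (F x) \<le> K * p x)
     \<and> (\<exists>K. \<forall>y\<in>T. p (inv_into S F y) \<le> K * q y)"

end

theory Submission
  imports Defs
begin

text \<open>
  Pasting \<open>g\<^sub>1\<close> on the left half-line and \<open>g\<^sub>2\<close> on the right one is a linear map that inverts
  \<open>E_ab\<close>, so linearity of \<open>E_ab\<close> and the subspace property of \<open>C_sharp\<close> come for free. That the
  image satisfies the defining equations of \<open>C_ab\<close> follows from the characterisation of
  \<open>y = e\<^sub>a * h\<close> as the solution of \<open>y' = h - a y\<close>, \<open>y(0) = 0\<close>. With \<open>a = \<alpha> + \<beta>\<close>, the bound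
  \<open>|y| \<le> sup |h| / a\<close> on the right half-line gives the norm constant 5.
\<close>

section \<open>Isomorphisms given by an explicit inverse\<close>

text \<open>Every point of \<open>S\<close> is some \<open>G u\<close> with \<open>u\<close> in
  \<open>T\<close>, and \<open>F\<close> takes it back to \<open>u\<close>; so linearity of
  \<open>F\<close> on \<open>S\<close> is linearity of \<open>G\<close> read backwards. On
  \<open>T\<close> the inverse \<open>inv_into S F\<close> is \<open>G\<close>, which turns the
  bound on the inverse into a bound on \<open>G\<close>.\<close>

lemma normed_isomorphismI:
  assumes G: "linear G" and T: "subspace T" and S: "S = G ` T"
    and FS: "\<And>x. x \<in> S \<Longrightarrow> F x \<in> T"
    and FG: "\<And>y. y \<in> T \<Longrightarrow> F (G y) = y"
    and bdF: "\<And>x. x \<in> S \<Longrightarrow> q (F x) \<le> K * p x"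
    and bdG: "\<And>y. y \<in> T \<Longrightarrow> p (G y) \<le> L * q y"
  shows "normed_isomorphism S p T q F"
proof -
  have add: "F (x + y) = F x + F y" if xy: "x \<in> S" "y \<in> S" for x y
  proof -
    obtain u v where uv: "u \<in> T" "v \<in> T" "x = G u" "y = G v"
      using xy S by auto
    have "F (G (u + v)) = u + v"
      using FG subspace_add[OF T] uv by blast
    then show ?thesis
      using FG uv linear_add[OF G] by simp
  qed
  have scale: "F (c *\<^sub>R x) = c *\<^sub>R F x" if x: "x \<in> S" for c x
  proof -
    obtain u where u: "u \<in> T" "x = G u"
      using x S by auto
    have "F (G (c *\<^sub>R u)) = c *\<^sub>R u"
      using FG subspace_scale[OF T] u by blast
    then show ?thesis
      using FG u linear_scale[OF G] by simp
  qed
  have bij: "bij_betw F S T"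
    by (rule bij_betw_byWitness[where f' = G]) (use S FS FG in auto)
  have inv: "inv_into S F y = G y" if "y \<in> T" for y
    using bij that S FG by (metis bij_betw_imp_inj_on image_eqI inv_into_f_f)
  have "\<exists>K. \<forall>x\<in>S. q (F x) \<le> K * p x" "\<exists>K. \<forall>y\<in>T. p (inv_into S F y) \<le> K * q y"
    using bdF bdG inv by metis+
  then show ?thesis
    unfolding normed_isomorphism_def
    using linear_subspace_image[OF G T] S T add scale bij by blast
qed

section \<open>Convolution with an exponential as the solution of an initial value problem\<close>

lemma conv_exp_fun:
  "conv (exp_fun a) h x = exp (- a * x) * (LBINT y=ereal 0..ereal x. exp (a * y) * h y)"
proof -
  have "exp (- a * (x - y)) * h y = exp (- a * x) * (exp (a * y) * h y)" for y
    by (simp add: algebra_simps flip: exp_add mult.assoc)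
  then show ?thesis
    unfolding conv_def exp_fun_def by (simp only: interval_lebesgue_integral_mult_right)
qed

text \<open>Only values strictly between 0 and \<open>x\<close> enter the integral. This allows a
  function with a jump at 0 to be replaced by a continuous one that agrees with it on one
  side.\<close>

lemma conv_cong:
  assumes "\<And>y. min 0 x < y \<Longrightarrow> y < max 0 x \<Longrightarrow> g y = h y"
  shows "conv k g x = conv k h x"
  unfolding conv_def
  by (intro interval_integral_cong) (use assms in \<open>auto simp: einterval_iff min_def max_def split: if_splits\<close>)

lemma conv_0 [simp]: "conv k h 0 = 0"
  by (simp add: conv_def)

text \<open>Uniqueness: with the integrating factor, \<open>exp (a * x) * y x\<close> is an
  antiderivative of \<open>exp (a * x) * h x\<close>. The orientation of the integral covers
  negative \<open>x\<close> as well.\<close>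

lemma conv_exp_fun_eqI:
  assumes h: "continuous_on UNIV h"
    and y: "\<And>x. (y has_real_derivative h x - a * y x) (at x)" and y0: "y 0 = 0"
  shows "conv (exp_fun a) h x = y x"
proof -
  have "(LBINT t=ereal 0..ereal x. exp (a * t) * h t) = exp (a * x) * y x - exp (a * 0) * y 0"
  proof (rule interval_integral_FTC_finite)
    show "continuous_on {min 0 x..max 0 x} (\<lambda>t. exp (a * t) * h t)"
      by (intro continuous_intros continuous_on_subset[OF h]) auto
    fix t
    have "((\<lambda>x. exp (a * x) * y x) has_real_derivative exp (a * t) * h t) (at t)"
      by (rule derivative_eq_intros y refl | simp add: algebra_simps)+
    then show "((\<lambda>x. exp (a * x) * y x) has_vector_derivative exp (a * t) * h t)
        (at t within {min 0 x..max 0 x})"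
      by (simp add: has_field_derivative_at_within flip: has_real_derivative_iff_has_vector_derivative)
  qed
  then show ?thesis
    by (simp add: conv_exp_fun y0 exp_minus)
qed

text \<open>Existence: a solution \<open>y\<close> vanishing at 0 is built from an antiderivative
  \<open>F\<close> of \<open>exp (a * x) * h x\<close>, and uniqueness identifies it with the
  convolution.\<close>

lemma conv_exp_fun_has_derivative:
  assumes h: "continuous_on UNIV h"
  shows "(conv (exp_fun a) h has_real_derivative h x - a * conv (exp_fun a) h x) (at x)"
proof -
  have c: "continuous_on UNIV (\<lambda>t. exp (a * t) * h t)"
    by (intro continuous_intros h)
  then have "\<exists>F. \<forall>x::real. -\<infinity> < ereal x \<longrightarrow> ereal x < \<infinity> \<longrightarrow>
      (F has_vector_derivative exp (a * x) * h x) (at x)"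
    by (intro einterval_antiderivative) (auto simp: continuous_on_eq_continuous_at)
  then obtain F where F: "(F has_real_derivative exp (a * x) * h x) (at x)" for x
    by (auto simp: has_real_derivative_iff_has_vector_derivative)
  define y where "y = (\<lambda>x. exp (- a * x) * (F x - F 0))"
  have y: "(y has_real_derivative h x - a * y x) (at x)" for x
    unfolding y_def
    by (rule derivative_eq_intros F refl | simp add: algebra_simps flip: exp_add)+
  have "conv (exp_fun a) h = y"
    using conv_exp_fun_eqI[OF h y] by (auto simp: y_def)
  with y show ?thesis by simp
qed

lemma continuous_on_conv_exp_fun:
  assumes "continuous_on UNIV h"
  shows "continuous_on A (conv (exp_fun a) h)"
  using conv_exp_fun_has_derivative[OF assms]
  by (meson DERIV_isCont continuous_at_imp_continuous_on)

text \<open>The sum of the two solutions vanishes at 0 and solves the equation with right-hand side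
  \<open>g + h\<close>, so uniqueness applies.\<close>

lemma conv_exp_fun_add:
  assumes g: "continuous_on UNIV g" and h: "continuous_on UNIV h"
  shows "conv (exp_fun a) (g + h) = conv (exp_fun a) g + conv (exp_fun a) h"
proof
  fix x
  have c: "continuous_on UNIV (g + h)"
    unfolding plus_fun_def by (intro continuous_intros g h)
  show "conv (exp_fun a) (g + h) x = (conv (exp_fun a) g + conv (exp_fun a) h) x"
    unfolding plus_fun_def
    by (rule conv_exp_fun_eqI[OF c[unfolded plus_fun_def]])
      (rule derivative_eq_intros conv_exp_fun_has_derivative g h refl | simp add: algebra_simps)+
qed

lemma conv_scaleR: "conv k (c *\<^sub>R h) = c *\<^sub>R conv k h"
  by (simp add: fun_eq_iff conv_def scaleR_fun_def mult.left_commute)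

section \<open>Bounds and limits of the convolution\<close>

text \<open>Comparison with the constant \<open>M / a\<close>, which solves the equation for the
  constant right-hand side \<open>M\<close>: the difference times \<open>exp (a * x)\<close> has
  derivative \<open>exp (a * x) * (M - h x)\<close>, which is nonnegative, and starts at
  \<open>M / a\<close>.\<close>

lemma conv_exp_fun_le:
  assumes a: "0 < a" and h: "continuous_on UNIV h"
    and M: "\<And>x. h x \<le> M" and M0: "0 \<le> M" and x: "0 \<le> x"
  shows "conv (exp_fun a) h x \<le> M / a"
proof -
  let ?u = "\<lambda>x. exp (a * x) * (M / a - conv (exp_fun a) h x)"
  have "?u 0 \<le> ?u x"
  proof (rule DERIV_nonneg_imp_nondecreasing[OF x])
    fix t
    have "(?u has_real_derivative exp (a * t) * (M - h t)) (at t)"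
      by (rule derivative_eq_intros conv_exp_fun_has_derivative h refl
          | use a in \<open>simp add: field_simps\<close>)+
    moreover have "0 \<le> exp (a * t) * (M - h t)"
      using M by simp
    ultimately show "\<exists>y. (?u has_real_derivative y) (at t) \<and> 0 \<le> y"
      by blast
  qed
  moreover have "0 \<le> ?u 0"
    using a M0 by simp
  ultimately have "0 \<le> ?u x" by linarith
  then show ?thesis
    by (simp add: zero_le_mult_iff)
qed

lemma abs_conv_exp_fun_le:
  assumes a: "0 < a" and h: "continuous_on UNIV h"
    and M: "\<And>x. \<bar>h x\<bar> \<le> M" and x: "0 \<le> x"
  shows "\<bar>conv (exp_fun a) h x\<bar> \<le> M / a"
proof -
  have M0: "0 \<le> M"
    using M[of 0] by linarith
  have "conv (exp_fun a) h x \<le> M / a"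
    by (rule conv_exp_fun_le[OF a h _ M0 x]) (use M abs_le_D1 in blast)
  moreover have "conv (exp_fun a) (- 1 *\<^sub>R h) x \<le> M / a"
  proof (rule conv_exp_fun_le[OF a _ _ M0 x])
    show "continuous_on UNIV (- 1 *\<^sub>R h)"
      unfolding scaleR_fun_def by (intro continuous_intros h)
    show "(- 1 *\<^sub>R h) t \<le> M" for t
      using M[of t] by (simp add: scaleR_fun_def)
  qed
  ultimately show ?thesis
    unfolding conv_scaleR by (simp add: scaleR_fun_def)
qed

text \<open>L'Hospital's rule for the convolution written as a quotient with denominator
  \<open>exp (a * x)\<close>: the quotient of the derivatives is \<open>h x / a\<close>.\<close>

lemma conv_exp_fun_tendsto:
  assumes a: "0 < a" and h: "continuous_on UNIV h" and l: "(h \<longlongrightarrow> l) at_top"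
  shows "(conv (exp_fun a) h \<longlongrightarrow> l / a) at_top"
proof -
  let ?I = "conv (exp_fun a) h"
  have "((\<lambda>x. exp (a * x) * ?I x / exp (a * x)) \<longlongrightarrow> l / a) at_top"
  proof (rule lhospital_at_top_at_top)
    show "LIM x at_top. exp (a * x) :> at_top"
      using a by (intro filterlim_compose[OF exp_at_top]
          filterlim_tendsto_pos_mult_at_top[OF tendsto_const _ filterlim_ident])
    show "\<forall>\<^sub>F x in at_top. ((\<lambda>x. exp (a * x) * ?I x) has_real_derivative exp (a * x) * h x) (at x)"
      by (intro always_eventually allI)
        (rule derivative_eq_intros conv_exp_fun_has_derivative h refl | simp add: algebra_simps)+
    show "\<forall>\<^sub>F x in at_top. ((\<lambda>x. exp (a * x)) has_real_derivative a * exp (a * x)) (at x)"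
      by (intro always_eventually allI) (rule derivative_eq_intros refl | simp)+
    show "\<forall>\<^sub>F x in at_top. a * exp (a * x) \<noteq> 0"
      using a by simp
    have "((\<lambda>x. h x / a) \<longlongrightarrow> l / a) at_top"
      using a by (intro tendsto_intros l) auto
    then show "((\<lambda>x. exp (a * x) * h x / (a * exp (a * x))) \<longlongrightarrow> l / a) at_top"
      by simp
  qed
  then show ?thesis by simp
qed

section \<open>Boundedness and supremum norms\<close>

text \<open>The limits bound \<open>f\<close> on two rays, compactness bounds it on
  \<open>{a..b}\<close> between them. If \<open>b < a\<close>, this interval is empty and the rays
  already cover the line.\<close>

lemma C_ext_bounded:
  assumes "f \<in> C_ext"
  obtains M where "\<And>x. \<bar>f x\<bar> \<le> M"
proof -
  obtain l m where f: "continuous_on UNIV f" "(f \<longlongrightarrow> l) at_bot" "(f \<longlongrightarrow> m) at_top"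
    using assms by (auto simp: C_ext_def)
  from f(2) have "\<forall>\<^sub>F x in at_bot. dist (f x) l < 1"
    by (rule tendstoD) simp
  then obtain a where a: "\<And>x. x \<le> a \<Longrightarrow> dist (f x) l < 1"
    by (auto simp: eventually_at_bot_linorder)
  from f(3) have "\<forall>\<^sub>F x in at_top. dist (f x) m < 1"
    by (rule tendstoD) simp
  then obtain b where b: "\<And>x. b \<le> x \<Longrightarrow> dist (f x) m < 1"
    by (auto simp: eventually_at_top_linorder)
  have "bounded (f ` {a..b})"
    by (intro compact_imp_bounded compact_continuous_image continuous_on_subset[OF f(1)]) auto
  then obtain c where c: "\<And>x. x \<in> {a..b} \<Longrightarrow> \<bar>f x\<bar> \<le> c"
    unfolding bounded_iff by (metis imageI real_norm_def)
  have "\<bar>f x\<bar> \<le> max c (max (\<bar>l\<bar> + 1) (\<bar>m\<bar> + 1))" for x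
    using a[of x] b[of x] c[of x] by (cases "x \<le> a"; cases "b \<le> x") (auto simp: dist_real_def)
  then show ?thesis
    by (rule that)
qed

text \<open>The bound \<open>M\<close> makes the set of values bounded above, as the conditionally
  complete supremum of the reals requires.\<close>

lemma abs_le_sup_norm_on:
  assumes "\<And>x. x \<in> A \<Longrightarrow> \<bar>f x\<bar> \<le> M" and "x \<in> A"
  shows "\<bar>f x\<bar> \<le> sup_norm_on A f"
  unfolding sup_norm_on_def
  by (rule cSUP_upper) (use assms in \<open>auto intro!: bdd_aboveI\<close>)

lemma sup_norm_on_le:
  assumes "\<And>x. x \<in> A \<Longrightarrow> \<bar>f x\<bar> \<le> M" and "A \<noteq> {}"
  shows "sup_norm_on A f \<le> M"
  unfolding sup_norm_on_def by (rule cSUP_least) (use assms in auto)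

lemma minus_0_real_nonempty: "- {0::real} \<noteq> {}"
proof
  assume "- {0::real} = {}"
  then have "(1::real) \<notin> - {0}" by simp
  then show False by simp
qed

section \<open>Even extensions of the two halves of a function\<close>

text \<open>Represents the right half of \<open>f\<close> by a continuous function on the whole
  line, whence the one-sided limit at 0. The left half is represented by
  \<open>even_ext (reflect f)\<close>.\<close>

definition even_ext :: "(real \<Rightarrow> real) \<Rightarrow> real \<Rightarrow> real" where
  "even_ext f x = (if x = 0 then Lim (at_right 0) f else f \<bar>x\<bar>)"

lemma even_ext_minus [simp]: "even_ext f (- x) = even_ext f x"
  by (simp add: even_ext_def)

lemma C_sharp_reflect:
  assumes "f \<in> C_sharp"
  shows "reflect f \<in> C_sharp"
proof -
  have "continuous_on (- {0}) (f \<circ> uminus)"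
    using assms
    by (intro continuous_on_compose continuous_intros) (auto simp: C_sharp_def elim: continuous_on_subset)
  then show ?thesis
    using assms
    by (auto simp: C_sharp_def reflect_def[abs_def] o_def filterlim_at_left_to_right[of f]
        filterlim_at_left_to_right[of "\<lambda>x. f (- x)"] filterlim_at_bot_mirror[of f]
        filterlim_at_bot_mirror[of "\<lambda>x. f (- x)"])
qed

lemma even_ext_C_ext:
  assumes "f \<in> C_sharp"
  shows "even_ext f \<in> C_ext"
proof -
  obtain l m where f: "continuous_on (- {0}) f" "(f \<longlongrightarrow> l) (at_right 0)" "(f \<longlongrightarrow> m) at_top"
    using assms by (auto simp: C_sharp_def)
  have L: "Lim (at_right 0) f = l"
    using f(2) by (intro tendsto_Lim) auto
  \<comment> \<open>The absolute value maps punctured neighbourhoods of 0 to the right of 0, so the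
    right-hand limit of \<open>f\<close> becomes a two-sided limit.\<close>
  have "filterlim abs (at_right 0) (at (0::real))"
    by (auto simp: filterlim_at eventually_at intro!: exI[of _ 1] tendsto_rabs_zero tendsto_ident_at)
  then have "((\<lambda>x. f \<bar>x\<bar>) \<longlongrightarrow> l) (at 0)"
    by (rule filterlim_compose[OF f(2)])
  then have "(even_ext f \<longlongrightarrow> l) (at 0)"
    by (rule Lim_transform_eventually)
      (auto simp: even_ext_def eventually_at intro!: exI[of _ 1])
  then have "(even_ext f \<longlongrightarrow> even_ext f 0) (at 0)"
    by (simp add: even_ext_def L)
  moreover have "isCont (even_ext f) x" if x: "x \<noteq> 0" for x
  proof -
    have "continuous_on (- {0}) (\<lambda>x. f \<bar>x\<bar>)"
      by (intro continuous_on_compose2[OF f(1)] continuous_intros) auto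
    then have "continuous_on (- {0}) (even_ext f)"
      by (rule continuous_on_eq) (simp add: even_ext_def)
    then show ?thesis
      using x by (simp add: continuous_on_eq_continuous_at open_Compl)
  qed
  ultimately have c: "continuous_on UNIV (even_ext f)"
    unfolding continuous_on_eq_continuous_at[OF open_UNIV] by (metis isCont_def)
  have top: "(even_ext f \<longlongrightarrow> m) at_top"
    by (rule Lim_transform_eventually[OF f(3)])
      (auto simp: even_ext_def intro!: eventually_mono[OF eventually_gt_at_top[of 0]])
  then have "(even_ext f \<longlongrightarrow> m) at_bot"
    by (simp add: filterlim_at_bot_mirror)
  with c top show ?thesis
    by (auto simp: C_ext_def)
qed

text \<open>The even continuous extension of \<open>f(y) - f(-y)\<close>, \<open>y > 0\<close>.\<close>

definition jump_ext :: "(real \<Rightarrow> real) \<Rightarrow> real \<Rightarrow> real" where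
  "jump_ext f x = even_ext f x - even_ext (reflect f) x"

lemma jump_ext_minus [simp]: "jump_ext f (- x) = jump_ext f x"
  by (simp add: jump_ext_def)

lemma continuous_on_jump_ext:
  assumes "f \<in> C_sharp"
  shows "continuous_on UNIV (jump_ext f)"
  unfolding jump_ext_def
  using even_ext_C_ext[OF assms] even_ext_C_ext[OF C_sharp_reflect[OF assms]]
  by (intro continuous_intros) (auto simp: C_ext_def)

text \<open>On the open interval from 0 to \<open>x\<close> the two integrands agree; the right-hand
  side convolves a continuous function, so the initial value problem is available.\<close>

lemma tilde_integral_eq_conv:
  assumes "0 \<le> x"
  shows "(LBINT y=ereal 0..ereal x. exp (- a * (x - y)) * (f y - f (- y)))
    = conv (exp_fun a) (jump_ext f) x"
proof -
  have "(LBINT y=ereal 0..ereal x. exp (- a * (x - y)) * (f y - f (- y)))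
    = conv (exp_fun a) (\<lambda>y. f y - f (- y)) x"
    by (simp add: conv_def exp_fun_def)
  also have "\<dots> = conv (exp_fun a) (jump_ext f) x"
    by (rule conv_cong) (use assms in \<open>auto simp: jump_ext_def even_ext_def reflect_def\<close>)
  finally show ?thesis .
qed

text \<open>One formula for all three cases: for \<open>x \<le> 0\<close> the argument
  \<open>max 0 x\<close> is 0, where the convolution vanishes, and the even extension of the left
  half remains.\<close>

lemma tilde_l_eq:
  "tilde_l \<alpha> \<beta> f x = even_ext (reflect f) x
    + 2 * \<alpha> * conv (exp_fun (\<alpha> + \<beta>)) (jump_ext f) (max 0 x)"
proof -
  \<comment> \<open>Matches the value at 0 prescribed by \<open>tilde_l\<close> with that of the
    even extension.\<close>
  have "Lim (at_left 0) f = Lim (at_right 0) (reflect f)"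
    by (simp add: t2_space_class.Lim_def filterlim_at_left_to_right[of f] reflect_def[abs_def])
  moreover note tilde_integral_eq_conv[of x "\<alpha> + \<beta>" f]
  ultimately show ?thesis
    by (auto simp: tilde_l_def even_ext_def reflect_def max_def)
qed

lemma tilde_r_eq:
  "tilde_r \<alpha> \<beta> f x = even_ext f x
    - 2 * \<beta> * conv (exp_fun (\<alpha> + \<beta>)) (jump_ext f) (max 0 (- x))"
  using tilde_integral_eq_conv[of "- x" "\<alpha> + \<beta>" f]
  by (auto simp: tilde_r_def even_ext_def max_def)

section \<open>The image of the transformation lies in \<open>C_ab\<close>\<close>

lemma C_ext_add_scaled:
  assumes "f \<in> C_ext" "g \<in> C_ext"
  shows "(\<lambda>x. f x + c * g x) \<in> C_ext"
proof -
  obtain k l m n where "(f \<longlongrightarrow> k) at_bot" "(g \<longlongrightarrow> l) at_bot" "(f \<longlongrightarrow> m) at_top" "(g \<longlongrightarrow> n) at_top"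
    using assms by (auto simp: C_ext_def)
  then have "((\<lambda>x. f x + c * g x) \<longlongrightarrow> k + c * l) at_bot"
      "((\<lambda>x. f x + c * g x) \<longlongrightarrow> m + c * n) at_top"
    by (auto intro: tendsto_add tendsto_mult_left)
  moreover have "continuous_on UNIV (\<lambda>x. f x + c * g x)"
    using assms by (intro continuous_intros) (auto simp: C_ext_def)
  ultimately show ?thesis
    by (auto simp: C_ext_def)
qed

lemma C_ext_reflect:
  assumes "f \<in> C_ext"
  shows "reflect f \<in> C_ext"
proof -
  have "continuous_on UNIV (f \<circ> uminus)"
    using assms
    by (intro continuous_on_compose continuous_intros) (auto simp: C_ext_def elim: continuous_on_subset)
  then show ?thesis
    using assms
    by (auto simp: C_ext_def reflect_def[abs_def] o_def filterlim_at_bot_mirror[of f]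
        filterlim_at_bot_mirror[of "\<lambda>x. f (- x)"])
qed

text \<open>The function is 0 on the left half-line; at infinity it tends to the limit of the jump
  divided by \<open>a\<close>.\<close>

lemma conv_jump_ext_C_ext:
  assumes a: "0 < a" and f: "f \<in> C_sharp"
  shows "(\<lambda>x. conv (exp_fun a) (jump_ext f) (max 0 x)) \<in> C_ext"
proof -
  let ?I = "conv (exp_fun a) (jump_ext f)"
  note c = continuous_on_jump_ext[OF f]
  obtain l m where "(even_ext f \<longlongrightarrow> l) at_top" "(even_ext (reflect f) \<longlongrightarrow> m) at_top"
    using even_ext_C_ext[OF f] even_ext_C_ext[OF C_sharp_reflect[OF f]]
    by (auto simp: C_ext_def)
  then have "(jump_ext f \<longlongrightarrow> l - m) at_top"
    unfolding jump_ext_def by (intro tendsto_intros)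
  from conv_exp_fun_tendsto[OF a c this] have "((\<lambda>x. ?I (max 0 x)) \<longlongrightarrow> (l - m) / a) at_top"
    by (rule Lim_transform_eventually)
      (auto intro!: eventually_mono[OF eventually_ge_at_top[of 0]])
  moreover have "((\<lambda>x. ?I (max 0 x)) \<longlongrightarrow> 0) at_bot"
    by (rule Lim_transform_eventually[OF tendsto_const])
      (auto intro!: eventually_mono[OF eventually_le_at_bot[of 0]] simp: max_def)
  moreover have "continuous_on UNIV (\<lambda>x. ?I (max 0 x))"
    by (rule continuous_on_compose2[OF continuous_on_conv_exp_fun[OF c, of UNIV]])
      (auto intro!: continuous_intros)
  ultimately show ?thesis
    by (auto simp: C_ext_def)
qed

text \<open>For negative arguments \<open>g\<^sub>2 - g\<^sub>1\<^sup>T\<close> is \<open>d - 2 (\<alpha> + \<beta>) I(- x)\<close>, where \<open>d\<close> is the jump and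
  \<open>I = e * d\<close>; both \<open>- I(- x)\<close> and its convolution solve the same initial value problem.\<close>

lemma conv_E_ab:
  assumes f: "f \<in> C_sharp"
  shows "conv (exp_fun (\<alpha> + \<beta>)) (tilde_r \<alpha> \<beta> f - reflect (tilde_l \<alpha> \<beta> f)) x
    = (if 0 \<le> x then conv (exp_fun (\<alpha> + \<beta>)) (jump_ext f) x
       else - conv (exp_fun (\<alpha> + \<beta>)) (jump_ext f) (- x))"
proof -
  let ?I = "conv (exp_fun (\<alpha> + \<beta>)) (jump_ext f)"
  let ?h = "tilde_r \<alpha> \<beta> f - reflect (tilde_l \<alpha> \<beta> f)"
  note c = continuous_on_jump_ext[OF f]
  have h: "?h t = jump_ext f t - 2 * (\<alpha> + \<beta>) * ?I (max 0 (- t))" for t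
    by (simp add: tilde_l_eq tilde_r_eq reflect_def jump_ext_def algebra_simps)
  show ?thesis
  proof (cases "0 \<le> x")
    case True
    then have "conv (exp_fun (\<alpha> + \<beta>)) ?h x = ?I x"
      by (intro conv_cong) (simp only: h, simp add: max_def)
    with True show ?thesis by simp
  next
    case False
    let ?h' = "\<lambda>t. jump_ext f t - 2 * (\<alpha> + \<beta>) * ?I (- t)"
    have "?h t = ?h' t" if "t < 0" for t
      unfolding h using that by (simp add: max_absorb2)
    with False have "conv (exp_fun (\<alpha> + \<beta>)) ?h x = conv (exp_fun (\<alpha> + \<beta>)) ?h' x"
      by (intro conv_cong) auto
    also have "\<dots> = - ?I (- x)"
    proof (rule conv_exp_fun_eqI)
      show "continuous_on UNIV ?h'"
        by (intro continuous_intros c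
            continuous_on_compose2[OF continuous_on_conv_exp_fun[OF c, of UNIV]]) auto
      fix t
      have "((\<lambda>t. ?I (- t)) has_real_derivative
          (jump_ext f (- t) - (\<alpha> + \<beta>) * ?I (- t)) * - 1) (at t)"
        by (rule DERIV_chain'[OF _ conv_exp_fun_has_derivative[OF c]])
          (rule derivative_eq_intros refl | simp)+
      from DERIV_minus[OF this]
      show "((\<lambda>t. - ?I (- t)) has_real_derivative ?h' t - (\<alpha> + \<beta>) * - ?I (- t)) (at t)"
        by (simp add: algebra_simps)
    qed simp
    finally show ?thesis
      using False by simp
  qed
qed

text \<open>The even extensions cancel in the odd parts. What is left is \<alpha> or \<beta> times
  the odd continuation of \<open>?I\<close> from the right half-line, which \<open>conv_E_ab\<close>
  identifies with the required convolution.\<close>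

lemma E_ab_in_C_ab:
  assumes a: "0 < \<alpha> + \<beta>" and f: "f \<in> C_sharp"
  shows "E_ab \<alpha> \<beta> f \<in> C_ab \<alpha> \<beta>"
proof -
  let ?I = "conv (exp_fun (\<alpha> + \<beta>)) (jump_ext f)"
  have I: "(\<lambda>x. ?I (max 0 x)) \<in> C_ext"
    by (rule conv_jump_ext_C_ext[OF a f])
  have "tilde_l \<alpha> \<beta> f \<in> C_ext"
    using C_ext_add_scaled[OF even_ext_C_ext[OF C_sharp_reflect[OF f]] I, of "2 * \<alpha>"]
    by (simp add: tilde_l_eq[abs_def])
  moreover have "tilde_r \<alpha> \<beta> f \<in> C_ext"
    using C_ext_add_scaled[OF even_ext_C_ext[OF f] C_ext_reflect[OF I], of "- 2 * \<beta>"]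
    by (simp add: tilde_r_eq[abs_def] reflect_def[abs_def])
  moreover have "odd_part (tilde_l \<alpha> \<beta> f)
      = \<alpha> *\<^sub>R conv (exp_fun (\<alpha> + \<beta>)) (tilde_r \<alpha> \<beta> f - reflect (tilde_l \<alpha> \<beta> f))"
    by (auto simp: fun_eq_iff scaleR_fun_def conv_E_ab[OF f] odd_part_def
        reflect_def tilde_l_eq max_def)
  moreover have "odd_part (tilde_r \<alpha> \<beta> f)
      = \<beta> *\<^sub>R conv (exp_fun (\<alpha> + \<beta>)) (tilde_r \<alpha> \<beta> f - reflect (tilde_l \<alpha> \<beta> f))"
    by (auto simp: fun_eq_iff scaleR_fun_def conv_E_ab[OF f] odd_part_def
        reflect_def tilde_r_eq max_def)
  ultimately show ?thesis
    by (simp add: E_ab_def C_ab_def)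
qed

section \<open>Pasting as the inverse map\<close>

definition glue :: "(real \<Rightarrow> real) \<times> (real \<Rightarrow> real) \<Rightarrow> real \<Rightarrow> real" where
  "glue g x = (if x < 0 then fst g x else if x = 0 then 0 else snd g x)"

lemma linear_glue: "linear glue"
  by (rule linearI) (auto simp: fun_eq_iff glue_def scaleR_fun_def)

lemma glue_E_ab:
  assumes "f \<in> C_sharp"
  shows "glue (E_ab \<alpha> \<beta> f) = f"
  using assms by (auto simp: fun_eq_iff glue_def E_ab_def tilde_l_def tilde_r_def C_sharp_def)

text \<open>Pasting overwrites the values at 0; they survive as the one-sided limits, from which
  \<open>E_ab\<close> recovers them.\<close>

lemma glue_tendsto_0:
  assumes "g\<^sub>1 \<in> C_ext" "g\<^sub>2 \<in> C_ext"
  shows "(glue (g\<^sub>1, g\<^sub>2) \<longlongrightarrow> g\<^sub>1 0) (at_left 0)" "(glue (g\<^sub>1, g\<^sub>2) \<longlongrightarrow> g\<^sub>2 0) (at_right 0)"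
proof -
  have lim: "(g\<^sub>1 \<longlongrightarrow> g\<^sub>1 0) (at_left 0)" "(g\<^sub>2 \<longlongrightarrow> g\<^sub>2 0) (at_right 0)"
    using assms
    by (auto simp: C_ext_def continuous_on_eq_continuous_at isCont_def intro: filterlim_at_withinI tendsto_within_subset)
  show "(glue (g\<^sub>1, g\<^sub>2) \<longlongrightarrow> g\<^sub>1 0) (at_left 0)"
    by (rule Lim_transform_eventually[OF lim(1)]) (auto simp: glue_def eventually_at_filter)
  show "(glue (g\<^sub>1, g\<^sub>2) \<longlongrightarrow> g\<^sub>2 0) (at_right 0)"
    by (rule Lim_transform_eventually[OF lim(2)]) (auto simp: glue_def eventually_at_filter)
qed

lemma glue_in_C_sharp:
  assumes g: "g\<^sub>1 \<in> C_ext" "g\<^sub>2 \<in> C_ext"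
  shows "glue (g\<^sub>1, g\<^sub>2) \<in> C_sharp"
proof -
  obtain l m where lm: "(g\<^sub>1 \<longlongrightarrow> l) at_bot" "(g\<^sub>2 \<longlongrightarrow> m) at_top"
    using g by (auto simp: C_ext_def)
  have "(glue (g\<^sub>1, g\<^sub>2) \<longlongrightarrow> l) at_bot"
    by (rule Lim_transform_eventually[OF lm(1)])
      (auto simp: glue_def intro!: eventually_mono[OF eventually_gt_at_bot[of 0]])
  moreover have "(glue (g\<^sub>1, g\<^sub>2) \<longlongrightarrow> m) at_top"
    by (rule Lim_transform_eventually[OF lm(2)])
      (auto simp: glue_def intro!: eventually_mono[OF eventually_gt_at_top[of 0]])
  moreover have "continuous_on (- {0}) (glue (g\<^sub>1, g\<^sub>2))"
  proof -
    have "continuous_on {..<0} (glue (g\<^sub>1, g\<^sub>2))"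
      by (rule continuous_on_eq[of _ g\<^sub>1])
        (use g in \<open>auto simp: C_ext_def glue_def elim: continuous_on_subset\<close>)
    moreover have "continuous_on {0<..} (glue (g\<^sub>1, g\<^sub>2))"
      by (rule continuous_on_eq[of _ g\<^sub>2])
        (use g in \<open>auto simp: C_ext_def glue_def elim: continuous_on_subset\<close>)
    moreover have "- {0} = {..<0} \<union> {0::real<..}"
      by auto
    ultimately show ?thesis
      by (simp add: continuous_on_open_Un)
  qed
  moreover have "glue (g\<^sub>1, g\<^sub>2) 0 = 0"
    by (simp add: glue_def)
  ultimately show ?thesis
    using glue_tendsto_0[OF g] by (auto simp: C_sharp_def)
qed

text \<open>For \<open>y > 0\<close> the pasted function has jump
  \<open>g\<^sub>2 y - g\<^sub>1 (- y)\<close>, so the integrals in \<open>E_ab\<close> are the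
  convolution \<open>?I\<close> of the defining equations. These equations, solved for
  \<open>g\<^sub>1 x\<close> and \<open>g\<^sub>2 (- x)\<close> with \<open>x > 0\<close>, are the
  formulas defining the two extensions.\<close>

lemma E_ab_glue:
  assumes g: "(g\<^sub>1, g\<^sub>2) \<in> C_ab \<alpha> \<beta>"
  shows "E_ab \<alpha> \<beta> (glue (g\<^sub>1, g\<^sub>2)) = (g\<^sub>1, g\<^sub>2)"
proof -
  let ?f = "glue (g\<^sub>1, g\<^sub>2)"
  let ?I = "conv (exp_fun (\<alpha> + \<beta>)) (g\<^sub>2 - reflect g\<^sub>1)"
  have ext: "g\<^sub>1 \<in> C_ext" "g\<^sub>2 \<in> C_ext"
    and odd: "odd_part g\<^sub>1 = \<alpha> *\<^sub>R ?I" "odd_part g\<^sub>2 = \<beta> *\<^sub>R ?I"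
    using g by (auto simp: C_ab_def)
  have odd1: "g\<^sub>1 x - g\<^sub>1 (- x) = 2 * \<alpha> * ?I x" for x
    using fun_cong[OF odd(1), of x] by (simp add: odd_part_def scaleR_fun_def reflect_def[of g\<^sub>1 x])
  have odd2: "g\<^sub>2 x - g\<^sub>2 (- x) = 2 * \<beta> * ?I x" for x
    using fun_cong[OF odd(2), of x] by (simp add: odd_part_def scaleR_fun_def reflect_def[of g\<^sub>2 x])
  have I: "(LBINT y=ereal 0..ereal x. exp (- (\<alpha> + \<beta>) * (x - y)) * (?f y - ?f (- y))) = ?I x"
    if "0 < x" for x
  proof -
    have "(LBINT y=ereal 0..ereal x. exp (- (\<alpha> + \<beta>) * (x - y)) * (?f y - ?f (- y)))
      = conv (exp_fun (\<alpha> + \<beta>)) (\<lambda>y. ?f y - ?f (- y)) x"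
      by (simp add: conv_def exp_fun_def)
    also have "\<dots> = ?I x"
      by (rule conv_cong) (use that in \<open>auto simp: glue_def reflect_def\<close>)
    finally show ?thesis .
  qed
  have L: "Lim (at_left 0) ?f = g\<^sub>1 0" "Lim (at_right 0) ?f = g\<^sub>2 0"
    using glue_tendsto_0[OF ext] by (auto intro!: tendsto_Lim)
  have "tilde_l \<alpha> \<beta> ?f x = g\<^sub>1 x" for x
    using odd1[of x] I[of x] by (auto simp: tilde_l_def L) (auto simp: glue_def)
  \<comment> \<open>The extended side is \<open>x < 0\<close> here, so the equation is read at the
    positive point \<open>- x\<close>.\<close>
  moreover have "tilde_r \<alpha> \<beta> ?f x = g\<^sub>2 x" for x
    using odd2[of "- x"] I[of "- x"] by (auto simp: tilde_r_def L) (auto simp: glue_def)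
  ultimately show ?thesis
    by (simp add: E_ab_def fun_eq_iff)
qed

section \<open>Linear structure of \<open>C_ab\<close>\<close>

text \<open>Odd part, reflection and convolution are linear, hence so are the defining equations;
  membership in \<open>C_ext\<close> supplies the continuity under which the convolution is shown to
  be additive.\<close>

lemma subspace_C_ab: "subspace (C_ab \<alpha> \<beta>)"
proof -
  have c: "continuous_on UNIV (h\<^sub>2 - reflect h\<^sub>1)" if "h\<^sub>1 \<in> C_ext" "h\<^sub>2 \<in> C_ext" for h\<^sub>1 h\<^sub>2
    unfolding fun_diff_def
    using that C_ext_reflect[OF that(1)] by (intro continuous_intros) (auto simp: C_ext_def)
  have conv_add: "conv (exp_fun (\<alpha> + \<beta>)) ((g\<^sub>2 - reflect g\<^sub>1) + (h\<^sub>2 - reflect h\<^sub>1))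
      = conv (exp_fun (\<alpha> + \<beta>)) (g\<^sub>2 - reflect g\<^sub>1) + conv (exp_fun (\<alpha> + \<beta>)) (h\<^sub>2 - reflect h\<^sub>1)"
    if "g\<^sub>1 \<in> C_ext" "g\<^sub>2 \<in> C_ext" "h\<^sub>1 \<in> C_ext" "h\<^sub>2 \<in> C_ext" for g\<^sub>1 g\<^sub>2 h\<^sub>1 h\<^sub>2
    using conv_exp_fun_add[OF c c] that by blast
  have odd_add: "odd_part (g + h) = odd_part g + odd_part h" for g h
    by (auto simp: fun_eq_iff odd_part_def reflect_def scaleR_fun_def algebra_simps)
  have odd_scale: "odd_part (r *\<^sub>R h) = r *\<^sub>R odd_part h" for r h
    by (auto simp: fun_eq_iff odd_part_def reflect_def scaleR_fun_def algebra_simps)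
  have diff_add: "(g\<^sub>2 + h\<^sub>2) - reflect (g\<^sub>1 + h\<^sub>1) = (g\<^sub>2 - reflect g\<^sub>1) + (h\<^sub>2 - reflect h\<^sub>1)"
    for g\<^sub>1 g\<^sub>2 h\<^sub>1 h\<^sub>2 :: "real \<Rightarrow> real"
    by (auto simp: fun_eq_iff reflect_def)
  have diff_scale: "(r *\<^sub>R h\<^sub>2) - reflect (r *\<^sub>R h\<^sub>1) = r *\<^sub>R (h\<^sub>2 - reflect h\<^sub>1)" for r h\<^sub>1 h\<^sub>2
    by (auto simp: fun_eq_iff reflect_def scaleR_fun_def algebra_simps)
  have ext0: "0 \<in> C_ext"
    by (auto simp: C_ext_def zero_fun_def)
  have ext_add: "g + h \<in> C_ext" if "g \<in> C_ext" "h \<in> C_ext" for g h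
    using C_ext_add_scaled[OF that, of 1] by (simp add: plus_fun_def)
  have ext_scale: "r *\<^sub>R h \<in> C_ext" if "h \<in> C_ext" for r h
    using C_ext_add_scaled[OF ext0 that, of r] by (simp add: scaleR_fun_def)
  have scale: "r *\<^sub>R g \<in> C_ab \<alpha> \<beta>" if "g \<in> C_ab \<alpha> \<beta>" for r g
    using that
    by (auto simp: C_ab_def ext_scale odd_scale diff_scale conv_scaleR mult.commute)
  have "g + h \<in> C_ab \<alpha> \<beta>" if "g \<in> C_ab \<alpha> \<beta>" "h \<in> C_ab \<alpha> \<beta>" for g h
    using that
    by (auto simp: C_ab_def ext_add odd_add diff_add conv_add scaleR_right_distrib)
  moreover have "0 \<in> C_ab \<alpha> \<beta>"
    using ext0
    by (auto simp: C_ab_def zero_prod_def odd_part_def reflect_def fun_eq_iff scaleR_fun_def conv_def)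
  ultimately show ?thesis
    using scale by (auto simp: subspace_def)
qed

section \<open>Norm estimates\<close>

text \<open>Boundedness of \<open>f\<close> comes from its two even extensions, one for each
  half-line.\<close>

lemma abs_le_norm_sharp:
  assumes f: "f \<in> C_sharp" and x: "x \<noteq> 0"
  shows "\<bar>f x\<bar> \<le> norm_sharp f"
proof -
  obtain M where M: "\<And>x. \<bar>even_ext f x\<bar> \<le> M"
    using C_ext_bounded[OF even_ext_C_ext[OF f]] by blast
  obtain N where N: "\<And>x. \<bar>even_ext (reflect f) x\<bar> \<le> N"
    using C_ext_bounded[OF even_ext_C_ext[OF C_sharp_reflect[OF f]]] by blast
  show ?thesis
    unfolding norm_sharp_def
  proof (rule abs_le_sup_norm_on)
    show "\<bar>f t\<bar> \<le> max M N" if "t \<in> - {0}" for t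
      using M[of t] N[of t] that by (cases "0 < t") (auto simp: even_ext_def reflect_def)
  qed (use x in auto)
qed

text \<open>Away from 0 the values are values of \<open>f\<close>; at 0 the bound passes to the
  limit by continuity.\<close>

lemma abs_even_ext_le:
  assumes f: "f \<in> C_sharp" and M: "\<And>x. x \<noteq> 0 \<Longrightarrow> \<bar>f x\<bar> \<le> M"
  shows "\<bar>even_ext f x\<bar> \<le> M"
proof (cases "x = 0")
  case True
  have "((\<lambda>x. \<bar>even_ext f x\<bar>) \<longlongrightarrow> \<bar>even_ext f 0\<bar>) (at 0)"
    using even_ext_C_ext[OF f]
    by (intro tendsto_intros) (auto simp: C_ext_def continuous_on_eq_continuous_at isCont_def)
  moreover have "\<forall>\<^sub>F x in at 0. \<bar>even_ext f x\<bar> \<le> M"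
    using M by (auto simp: eventually_at_filter even_ext_def)
  ultimately show ?thesis
    using True by (simp add: tendsto_upperbound)
qed (use M in \<open>simp add: even_ext_def\<close>)

text \<open>The constant is 1 + 4: the even extension contributes at most \<open>?N\<close>. The
  jump is at most \<open>2 * ?N\<close>, so the integral term is at most
  \<open>2 * c * (2 * ?N) / (\<alpha> + \<beta>)\<close> with \<open>c\<close> equal to \<alpha> or
  \<beta>, and \<open>c \<le> \<alpha> + \<beta>\<close>.\<close>

lemma norm_E_ab_le:
  assumes nonneg: "0 \<le> \<alpha>" "0 \<le> \<beta>" and a: "0 < \<alpha> + \<beta>" and f: "f \<in> C_sharp"
  shows "norm_pair (E_ab \<alpha> \<beta> f) \<le> 5 * norm_sharp f"
proof -
  let ?I = "conv (exp_fun (\<alpha> + \<beta>)) (jump_ext f)"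
  let ?N = "norm_sharp f"
  have R: "\<bar>even_ext f x\<bar> \<le> ?N" for x
    by (rule abs_even_ext_le[OF f abs_le_norm_sharp[OF f]])
  have L: "\<bar>even_ext (reflect f) x\<bar> \<le> ?N" for x
    by (rule abs_even_ext_le[OF C_sharp_reflect[OF f]])
      (use abs_le_norm_sharp[OF f] in \<open>simp add: reflect_def\<close>)
  have "\<bar>jump_ext f x\<bar> \<le> 2 * ?N" for x
    using R[of x] L[of x] unfolding jump_ext_def by linarith
  from abs_conv_exp_fun_le[OF a continuous_on_jump_ext[OF f] this]
  have I: "(\<alpha> + \<beta>) * \<bar>?I (max 0 x)\<bar> \<le> 2 * ?N" for x
    using a by (simp add: field_simps)
  have bound: "\<bar>2 * c * ?I (max 0 x)\<bar> \<le> 4 * ?N" if "0 \<le> c" "c \<le> \<alpha> + \<beta>" for c x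
  proof -
    have "c * \<bar>?I (max 0 x)\<bar> \<le> (\<alpha> + \<beta>) * \<bar>?I (max 0 x)\<bar>"
      by (rule mult_right_mono) (use that in auto)
    with I[of x] that show ?thesis
      by (simp add: abs_mult)
  qed
  have "\<bar>tilde_l \<alpha> \<beta> f x\<bar> \<le> 5 * ?N" for x
    using L[of x] bound[of \<alpha> x] nonneg unfolding tilde_l_eq by simp
  moreover have "\<bar>tilde_r \<alpha> \<beta> f x\<bar> \<le> 5 * ?N" for x
    using R[of x] bound[of \<beta> "- x"] nonneg unfolding tilde_r_eq by simp
  ultimately show ?thesis
    by (simp add: norm_pair_def E_ab_def sup_norm_on_le)
qed

lemma norm_glue_le:
  assumes g: "g\<^sub>1 \<in> C_ext" "g\<^sub>2 \<in> C_ext"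
  shows "norm_sharp (glue (g\<^sub>1, g\<^sub>2)) \<le> norm_pair (g\<^sub>1, g\<^sub>2)"
proof -
  have "\<bar>h x\<bar> \<le> sup_norm_on UNIV h" if h: "h \<in> C_ext" for h x
  proof -
    obtain M where "\<And>x. \<bar>h x\<bar> \<le> M"
      using C_ext_bounded[OF h] by blast
    then show ?thesis
      by (intro abs_le_sup_norm_on) auto
  qed
  note bound = this[OF g(1)] this[OF g(2)]
  have "\<bar>glue (g\<^sub>1, g\<^sub>2) x\<bar> \<le> norm_pair (g\<^sub>1, g\<^sub>2)" if "x \<in> - {0}" for x
    using bound[of x] that by (simp add: glue_def norm_pair_def le_max_iff_disj)
  then show ?thesis
    unfolding norm_sharp_def by (rule sup_norm_on_le[OF _ minus_0_real_nonempty])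
qed

theorem proposition2p4:
  fixes \<alpha> \<beta> :: real
  assumes "0 \<le> \<alpha>" and "0 \<le> \<beta>" and "0 < \<alpha> + \<beta>"
  shows "normed_isomorphism C_sharp norm_sharp (C_ab \<alpha> \<beta>) norm_pair (E_ab \<alpha> \<beta>)"
proof (rule normed_isomorphismI[OF linear_glue subspace_C_ab])
  have glue: "glue g \<in> C_sharp" if "g \<in> C_ab \<alpha> \<beta>" for g
    using that by (auto simp: C_ab_def intro: glue_in_C_sharp)
  show E: "E_ab \<alpha> \<beta> f \<in> C_ab \<alpha> \<beta>" if "f \<in> C_sharp" for f
    by (rule E_ab_in_C_ab[OF assms(3) that])
  \<comment> \<open>Each \<open>f\<close> is the pasting of its own image under
    \<open>E_ab\<close>.\<close>
  show "C_sharp = glue ` C_ab \<alpha> \<beta>"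
  proof
    show "C_sharp \<subseteq> glue ` C_ab \<alpha> \<beta>"
      using E by (metis glue_E_ab image_eqI subsetI)
  qed (use glue in blast)
  show "E_ab \<alpha> \<beta> (glue g) = g" if "g \<in> C_ab \<alpha> \<beta>" for g
    using that E_ab_glue by (cases g) blast
  show "norm_pair (E_ab \<alpha> \<beta> f) \<le> 5 * norm_sharp f" if "f \<in> C_sharp" for f
    by (rule norm_E_ab_le[OF assms that])
  show "norm_sharp (glue g) \<le> 1 * norm_pair g" if "g \<in> C_ab \<alpha> \<beta>" for g
    using that norm_glue_le by (auto simp: C_ab_def)
qed

end
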